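(* Let $3\le m<n+2$. Let $X$ be a spherical $\psi_m$-code in $\mathbb S^{d-1}$, where $d:=n+2-m$ and $\psi_m:=\arccos\left(\frac{1}{m-1}\right)$. Then for any family $\mathcal F$ of $m$ mutually tangent spheres in $\mathbb R^n$ there is an $\mathcal F$-kissing arrangement that corresponds to $X$.
   Context: A set $X$ of points in the unit sphere $\mathbb S^{d-1}$ is a spherical $\psi$-code if the angular distance between distinct points of $X$ is at least $\psi$. Two distinct spheres in $\mathbb R^n$ are called non-intersecting if their intersection is not a sphere of radius $r>0$, i.e. they are either disjoint or touch each other. For a family $\mathcal F=\{S_1,\ldots,S_m\}$ of spheres in $\mathbb R^n$ (each $S_i$ can be a sphere of any radius or a hyperplane), a set $\mathcal C$ of spheres in $\mathbb R^n$ is an $\mathcal F$-kissing arrangement if (1) each sphere from $\mathcal C$ is tangent to all spheres from $\mathcal F$; (2) each sphere from $\mathcal C$ is tangent to at least one sphere from $\mathcal C$; (3) any two distinct spheres from $\mathcal C$ are non-intersecting. The correspondence between $\mathcal F$-kissing arrangements and spherical codes, for $\mathcal F$ a family of $m\ge3$ mutually tangent spheres, is as follows. Let $T$ be an inversion centered at the contact point of $S_1$ and $S_2$ (followed by a rescaling), so that $S'_1:=T(S_1)$ and $S'_2:=T(S_2)$ are two parallel hyperplanes, normalized to be at distance $2$, so that the images under $T$ of the spheres of $\mathcal F$-kissing arrangements are unit spheres. Put $S'_i:=T(S_i)$, let $Z_0$ be the hyperplane of symmetry of $S'_1$ and $S'_2$, and for $3\le i\le m$ let $Z_i$ be the sphere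 concentric with $S'_i$ of radius $r_i+1$, where $r_i$ is the radius of $S'_i$. Let $S_{\mathcal F}=Z_0\cap Z_3\cap\cdots\cap Z_m$ be the locus of centers of unit spheres tangent to all $S'_i$; it is a $(d-1)$-dimensional sphere. Let $f$ be the central projection of $S_{\mathcal F}$ onto the concentric unit sphere, identified with $\mathbb S^{d-1}$. An $\mathcal F$-kissing arrangement $P$ corresponds to $X$ if $X=f(c_P)$, where $c_P$ is the set of centers of the spheres in $T(P)$.
   Formalization: Condition (2) fails for some X (e.g. one point), so (1), (3) and the correspondence are proved, with (2) holding iff each point of X has another at angle exactly ψ_m; the spheres of F may not all touch at one point (Z_i undefined); arrangement members may be hyperplanes. *)

theory Defs
  imports "HOL-Analysis.Analysis"
begin

text \<open>
  Spheres and hyperplanes live in the one-point compactification, modelled as \<^typ>\<open>'a option\<close>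
  with \<^term>\<open>None\<close> as the point at infinity, which lies on every hyperplane and on no sphere.
  Inversions are total there; parallel hyperplanes touch at infinity.
\<close>

definition esphere :: "'a::euclidean_space \<Rightarrow> real \<Rightarrow> 'a option set" where
  "esphere c r = Some ` sphere c r"

definition ehyperplane :: "'a::euclidean_space \<Rightarrow> real \<Rightarrow> 'a option set" where
  "ehyperplane a b = insert None (Some ` {x. a \<bullet> x = b})"

definition gsphere :: "'a::euclidean_space option set \<Rightarrow> bool" where
  "gsphere A \<longleftrightarrow> (\<exists>c r. 0 < r \<and> A = esphere c r) \<or> (\<exists>a b. a \<noteq> 0 \<and> A = ehyperplane a b)"

text \<open>
  In dimension at least 2, generalized spheres meet in nothing, in one point (they touch), or in a
  sphere of positive radius (extended by infinity if flat), or they coincide. In particular no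
  sphere is tangent to itself.
\<close>

definition tangent :: "'a::euclidean_space option set \<Rightarrow> 'a option set \<Rightarrow> bool" where
  "tangent A B \<longleftrightarrow> (\<exists>p. A \<inter> B = {p})"

definition non_intersecting :: "'a::euclidean_space option set \<Rightarrow> 'a option set \<Rightarrow> bool" where
  "non_intersecting A B \<longleftrightarrow> A \<inter> B = {} \<or> tangent A B"

text \<open>
  The members of a family of mutually tangent spheres touch at pairwise distinct points. Spheres
  all touching at one common point are excluded: inversion there turns them into more than two
  parallel hyperplanes, which have no common tangent sphere other than parallel hyperplanes.
\<close>

definition mutually_tangent :: "nat \<Rightarrow> (nat \<Rightarrow> 'a::euclidean_space option set) \<Rightarrow> bool" where
  "mutually_tangent m S \<longleftrightarrow>
     (\<forall>i\<in>{1..m}. gsphere (S i)) \<and>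
     (\<forall>i\<in>{1..m}. \<forall>j\<in>{1..m}. i \<noteq> j \<longrightarrow> tangent (S i) (S j)) \<and>
     (\<forall>i\<in>{1..m}. \<forall>j\<in>{1..m}. \<forall>k\<in>{1..m}. i \<noteq> j \<and> i \<noteq> k \<and> j \<noteq> k \<longrightarrow> S i \<inter> S j \<inter> S k = {})"

definition tangent_to_all ::
  "'a::euclidean_space option set set \<Rightarrow> 'a option set set \<Rightarrow> bool" where
  "tangent_to_all F C \<longleftrightarrow> (\<forall>A\<in>C. gsphere A \<and> (\<forall>B\<in>F. tangent A B))"

text \<open>
  The middle condition asks for another member of \<open>C\<close>, as no sphere is tangent to itself. Under
  the correspondence with a code it says that every code point has one at angle exactly \<open>\<psi>\<close>; a
  \<open>\<psi>\<close>-code need not have this property (a one-point code never does).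
\<close>

definition kissing_arrangement ::
  "'a::euclidean_space option set set \<Rightarrow> 'a option set set \<Rightarrow> bool" where
  "kissing_arrangement F C \<longleftrightarrow>
     tangent_to_all F C \<and>
     (\<forall>A\<in>C. \<exists>B\<in>C. tangent A B) \<and>
     pairwise non_intersecting C"

definition angular_dist :: "'b::euclidean_space \<Rightarrow> 'b \<Rightarrow> real" where
  "angular_dist x y = arccos (x \<bullet> y)"

definition spherical_code :: "real \<Rightarrow> 'b::euclidean_space set \<Rightarrow> bool" where
  "spherical_code \<psi> X \<longleftrightarrow> X \<subseteq> sphere 0 1 \<and> pairwise (\<lambda>x y. \<psi> \<le> angular_dist x y) X"

text \<open>Inversion in the unit sphere about a point; centred at infinity it is the identity.\<close>

fun inversion :: "'a::euclidean_space option \<Rightarrow> 'a option \<Rightarrow> 'a option" where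
  "inversion None z = z"
| "inversion (Some p) None = Some p"
| "inversion (Some p) (Some x) =
     (if x = p then None else Some (p + (1 / (norm (x - p))\<^sup>2) *\<^sub>R (x - p)))"

definition normalization ::
  "(nat \<Rightarrow> 'a::euclidean_space option set) \<Rightarrow> ('a option \<Rightarrow> 'a option) \<Rightarrow> bool" where
  "normalization S T \<longleftrightarrow>
     (\<exists>q k. S 1 \<inter> S 2 = {q} \<and> 0 < k \<and> T = map_option ((*\<^sub>R) k) \<circ> inversion q) \<and>
     (\<exists>a b. norm a = 1 \<and> T ` S 1 = ehyperplane a b \<and> T ` S 2 = ehyperplane a (b + 2))"

definition midplane :: "'a::euclidean_space option set \<Rightarrow> 'a option set \<Rightarrow> 'a set" where
  "midplane A B =
     {x. \<exists>a b c. a \<noteq> 0 \<and> A = ehyperplane a b \<and> B = ehyperplane a c \<and> a \<bullet> x = (b + c) / 2}"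

definition enlarged_sphere :: "'a::euclidean_space option set \<Rightarrow> 'a set" where
  "enlarged_sphere A = {x. \<exists>c r. 0 < r \<and> A = esphere c r \<and> x \<in> sphere c (r + 1)}"

definition center_locus ::
  "nat \<Rightarrow> (nat \<Rightarrow> 'a::euclidean_space option set) \<Rightarrow> ('a option \<Rightarrow> 'a option) \<Rightarrow> 'a set" where
  "center_locus m S T =
     midplane (T ` S 1) (T ` S 2) \<inter> (\<Inter>i\<in>{3..m}. enlarged_sphere (T ` S i))"

text \<open>
  \<open>identification L z e\<close>: the set \<open>L\<close> is a sphere with centre \<open>z\<close> in the affine subspace
  \<open>z + range e\<close>, of dimension \<open>DIM('b) - 1\<close>, and \<open>\<lambda>u. z + e u\<close> identifies the unit sphere of
  \<open>'b\<close> isometrically with the unit sphere concentric with \<open>L\<close>.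
\<close>

definition identification ::
  "'a::euclidean_space set \<Rightarrow> 'a \<Rightarrow> ('b::euclidean_space \<Rightarrow> 'a) \<Rightarrow> bool" where
  "identification L z e \<longleftrightarrow>
     linear e \<and> (\<forall>v. norm (e v) = norm v) \<and>
     (\<exists>R>0. L = (\<lambda>u. z + R *\<^sub>R e u) ` sphere 0 1)"

definition central_projection ::
  "'a::euclidean_space \<Rightarrow> ('b::euclidean_space \<Rightarrow> 'a) \<Rightarrow> 'a \<Rightarrow> 'b" where
  "central_projection z e x =
     inv_into (sphere 0 1) (\<lambda>u. z + e u) (z + (1 / norm (x - z)) *\<^sub>R (x - z))"

definition centers :: "'a::euclidean_space option set set \<Rightarrow> 'a set" where
  "centers Q = {c. \<exists>r>0. esphere c r \<in> Q}"

definition corresponds ::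
  "nat \<Rightarrow> (nat \<Rightarrow> 'a::euclidean_space option set) \<Rightarrow> ('a option \<Rightarrow> 'a option) \<Rightarrow>
   'a \<Rightarrow> ('b::euclidean_space \<Rightarrow> 'a) \<Rightarrow> 'a option set set \<Rightarrow> 'b set \<Rightarrow> bool" where
  "corresponds m S T z e P X \<longleftrightarrow>
     centers ((`) T ` P) \<subseteq> center_locus m S T \<and>
     X = central_projection z e ` centers ((`) T ` P)"

end

theory Submission
  imports Defs
begin

text \<open>
  Inverting at the contact point of \<open>S 1\<close> and \<open>S 2\<close> turns these two spheres into parallel
  hyperplanes at distance 2, and the remaining ones into unit spheres whose centres form a regular
  simplex with \<open>m - 2\<close> vertices and edge 2 in the midplane. The points at distance 2 from all
  vertices form a sphere of squared radius \<open>R\<^sup>2 = 2 * (m - 1) / (m - 2)\<close> about the centroid, in the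
  orthogonal complement of the simplex. Two points of it at angle \<open>\<phi>\<close> have squared distance
  \<open>2 * R\<^sup>2 * (1 - cos \<phi>)\<close>, so unit spheres centred there do not overlap iff \<open>cos \<phi> \<le> 1 / (m - 1)\<close>,
  and they touch in the case of equality. Pulling these unit spheres back by the inversion gives the
  arrangement.
\<close>

section \<open>Points and parameters of spheres and hyperplanes\<close>

text \<open>Antipodal points \<open>c + v\<close> and \<open>c - v\<close> both satisfy the second
  equation, and subtracting the two instances makes \<open>v\<close> orthogonal to
  \<open>c - c'\<close>. Taking \<open>v\<close> along \<open>c - c'\<close> forces the centres to
  agree. Thus centre and radius can be read off from the point set, as \<open>centers\<close> and
  \<open>enlarged_sphere\<close> presuppose.\<close>

lemma sphere_eq_sphereD:
  fixes c c' :: "'a::euclidean_space"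
  assumes "0 < r" "sphere c r = sphere c' r'"
  shows "c = c' \<and> r = r'"
proof -
  have on: "norm (x - c') = r'" if "norm (x - c) = r" for x
    using that assms(2) by (metis dist_norm mem_sphere dist_commute)
  have "v \<bullet> (c - c') = 0 \<and> (norm v)\<^sup>2 + (norm (c - c'))\<^sup>2 = r'\<^sup>2" if "norm v = r" for v
  proof -
    have "norm (v + (c - c')) = r'" "norm (- v + (c - c')) = r'"
      using on[of "c + v"] on[of "c - v"] that by (simp_all add: algebra_simps)
    then have "(v + (c - c')) \<bullet> (v + (c - c')) = r'\<^sup>2" "(- v + (c - c')) \<bullet> (- v + (c - c')) = r'\<^sup>2"
      by (simp_all flip: power2_norm_eq_inner)
    then show ?thesis
      by (simp add: inner_add inner_diff inner_commute power2_norm_eq_inner)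
  qed
  note * = this
  have "c = c'"
  proof (rule ccontr)
    assume "c \<noteq> c'"
    then show False
      using *[of "(r / norm (c - c')) *\<^sub>R (c - c')"] assms(1) by simp
  qed
  moreover obtain v :: 'a where "norm v = r"
    using vector_choose_size[of r] assms(1) by auto
  ultimately have "r\<^sup>2 = r'\<^sup>2" and "0 \<le> r'"
    using *[of v] on[of "c + v"] by auto
  then show ?thesis
    using \<open>c = c'\<close> assms(1) by (simp add: power2_eq_iff_nonneg)
qed

lemma esphere_eq_iff:
  assumes "0 < r"
  shows "esphere c r = esphere c' r' \<longleftrightarrow> c = c' \<and> r = r'"
proof
  assume "esphere c r = esphere c' r'"
  then have "sphere c r = sphere c' r'"
    unfolding esphere_def by (simp only: inj_image_eq_iff inj_Some)
  then show "c = c' \<and> r = r'"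
    by (rule sphere_eq_sphereD[OF assms])
qed simp

lemma Some_in_esphere_iff [simp]: "Some x \<in> esphere c r \<longleftrightarrow> dist c x = r"
  by (simp add: esphere_def inj_image_mem_iff)

lemma None_notin_esphere [simp]: "None \<notin> esphere c r"
  by (simp add: esphere_def image_iff)

lemma Some_in_ehyperplane_iff [simp]: "Some x \<in> ehyperplane a b \<longleftrightarrow> a \<bullet> x = b"
  by (simp add: ehyperplane_def inj_image_mem_iff)

lemma None_in_ehyperplane [simp]: "None \<in> ehyperplane a b"
  by (simp add: ehyperplane_def)

lemma ehyperplane_scaleR:
  "t \<noteq> 0 \<Longrightarrow> ehyperplane (t *\<^sub>R a) (t * b) = ehyperplane a b"
  by (simp add: ehyperplane_def)

section \<open>Quadric equations and inversion\<close>

text \<open>The equation of a generalized sphere in coordinates about \<open>p\<close>. Inversion at \<open>p\<close> swaps \<open>\<alpha>\<close> and \<open>\<gamma>\<close>.\<close>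

definition quadric :: "'a::euclidean_space \<Rightarrow> real \<Rightarrow> 'a \<Rightarrow> real \<Rightarrow> 'a option set" where
  "quadric p \<alpha> v \<gamma> =
     {z. case z of None \<Rightarrow> \<alpha> = 0 | Some x \<Rightarrow> \<alpha> * (norm (x - p))\<^sup>2 + v \<bullet> (x - p) + \<gamma> = 0}"

lemma esphere_eq_quadric:
  assumes "0 < r"
  shows "esphere c r = quadric p 1 (2 *\<^sub>R (p - c)) ((norm (p - c))\<^sup>2 - r\<^sup>2)"
proof -
  have "dist c x = r \<longleftrightarrow> (norm (x - p))\<^sup>2 + 2 * ((p - c) \<bullet> (x - p)) + ((norm (p - c))\<^sup>2 - r\<^sup>2) = 0" for x
  proof -
    have "dist c x = r \<longleftrightarrow> (norm ((x - p) + (p - c)))\<^sup>2 = r\<^sup>2"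
      using assms by (simp add: dist_norm norm_minus_commute power2_eq_iff_nonneg)
    then show ?thesis
      unfolding dot_norm[of "x - p" "p - c"] inner_commute[of "p - c"] by (simp add: field_simps)
  qed
  moreover have "z \<in> esphere c r \<longleftrightarrow> (case z of None \<Rightarrow> False | Some x \<Rightarrow> dist c x = r)" for z
    by (cases z) (auto simp: esphere_def)
  ultimately show ?thesis
    by (intro set_eqI) (simp add: quadric_def split: option.split)
qed

lemma ehyperplane_eq_quadric: "ehyperplane a b = quadric p 0 a (a \<bullet> p - b)"
proof (rule set_eqI)
  show "z \<in> ehyperplane a b \<longleftrightarrow> z \<in> quadric p 0 a (a \<bullet> p - b)" for z
    by (cases z) (auto simp: ehyperplane_def quadric_def inner_diff_right)
qed

text \<open>The discriminant condition excludes the empty set and single points when \<alpha> is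
  nonzero, and says \<open>v \<noteq> 0\<close> when \<alpha> vanishes. Spheres and hyperplanes are
  thus handled by one formula, about any chosen base point.\<close>

lemma gsphere_iff_quadric:
  "gsphere A \<longleftrightarrow> (\<exists>\<alpha> v \<gamma>. 4 * \<alpha> * \<gamma> < v \<bullet> v \<and> A = quadric p \<alpha> v \<gamma>)" (is "_ \<longleftrightarrow> ?R")
proof
  assume "gsphere A"
  then consider c r where "0 < r" "A = esphere c r" | a b where "a \<noteq> 0" "A = ehyperplane a b"
    unfolding gsphere_def by blast
  then show ?R
  proof cases
    case 1
    have "4 * 1 * ((norm (p - c))\<^sup>2 - r\<^sup>2) < (2 *\<^sub>R (p - c)) \<bullet> (2 *\<^sub>R (p - c))"
      using \<open>0 < r\<close> by (simp add: power2_norm_eq_inner)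
    then show ?thesis
      using 1 esphere_eq_quadric[of r c p] by blast
  next
    case 2
    then have "4 * 0 * (a \<bullet> p - b) < a \<bullet> a" by simp
    then show ?thesis
      using 2 ehyperplane_eq_quadric[of a b p] by blast
  qed
next
  assume ?R
  then obtain \<alpha> v \<gamma> where disc: "4 * \<alpha> * \<gamma> < v \<bullet> v" and A: "A = quadric p \<alpha> v \<gamma>" by blast
  show "gsphere A"
  proof (cases "\<alpha> = 0")
    case True
    then have "A = ehyperplane v (v \<bullet> p - \<gamma>)" "v \<noteq> 0"
      using A disc ehyperplane_eq_quadric[of v "v \<bullet> p - \<gamma>" p] by auto
    then show ?thesis unfolding gsphere_def by blast
  next
    case False
    \<comment> \<open>Centre and radius come from completing the square after division by \<alpha>;
      the absolute value keeps \<open>r\<close> positive for negative \<alpha>.\<close>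
    define c where "c = p - (1 / (2 * \<alpha>)) *\<^sub>R v"
    define r where "r = sqrt (v \<bullet> v - 4 * \<alpha> * \<gamma>) / (2 * \<bar>\<alpha>\<bar>)"
    have r: "0 < r" using disc False by (simp add: r_def)
    have r2: "r\<^sup>2 = (v \<bullet> v - 4 * \<alpha> * \<gamma>) / (4 * \<alpha>\<^sup>2)"
      using disc by (simp add: r_def power_divide power_mult_distrib)
    have "(norm (p - c))\<^sup>2 = (v \<bullet> v) / (4 * \<alpha>\<^sup>2)"
      unfolding c_def power2_norm_eq_inner using False by (simp add: power2_eq_square)
    then have "(norm (p - c))\<^sup>2 - r\<^sup>2 = \<gamma> / \<alpha>"
      unfolding r2 using False by (simp add: field_simps power2_eq_square)
    moreover have "2 *\<^sub>R (p - c) = (1 / \<alpha>) *\<^sub>R v" by (simp add: c_def)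
    ultimately have "esphere c r = quadric p 1 ((1 / \<alpha>) *\<^sub>R v) (\<gamma> / \<alpha>)"
      using esphere_eq_quadric[OF r, of c p] by simp
    also have "\<dots> = A"
    proof (rule set_eqI)
      fix z
      have "t + s / \<alpha> + \<gamma> / \<alpha> = 0 \<longleftrightarrow> \<alpha> * t + s + \<gamma> = 0" for t s
        using False by (simp add: field_simps)
      then show "z \<in> quadric p 1 ((1 / \<alpha>) *\<^sub>R v) (\<gamma> / \<alpha>) \<longleftrightarrow> z \<in> A"
        unfolding A quadric_def using False by (cases z) simp_all
    qed
    finally show ?thesis
      using r unfolding gsphere_def by blast
  qed
qed

lemma inversion_inversion [simp]: "inversion q (inversion q z) = z"
proof (cases q)
  case (Some p)
  show ?thesis
  proof (cases z)
    case (Some x)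
    show ?thesis
    proof (cases "x = p")
      case False
      define N where "N = (norm (x - p))\<^sup>2"
      have N: "N \<noteq> 0" using False by (simp add: N_def)
      have norm: "(norm ((1 / N) *\<^sub>R (x - p)))\<^sup>2 = 1 / N"
        using N by (simp add: power_divide flip: N_def) (simp add: power2_eq_square)
      define y where "y = p + (1 / N) *\<^sub>R (x - p)"
      have yp: "y - p = (1 / N) *\<^sub>R (x - p)" "y \<noteq> p" using N False by (simp_all add: y_def)
      have "inversion q z = Some y"
        using False Some \<open>q = Some p\<close> by (simp add: y_def N_def)
      moreover have "inversion (Some p) (Some y) = Some x"
        using yp(2) N by (simp only: inversion.simps yp(1) norm if_False) simp
      ultimately show ?thesis
        using Some \<open>q = Some p\<close> by simp
    qed (simp add: Some \<open>q = Some p\<close>)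
  qed (simp add: Some)
qed simp

text \<open>For finite \<open>x \<noteq> p\<close>, inversion divides \<open>x - p\<close> by its
  squared norm \<open>N\<close> and turns \<open>N\<close> into \<open>1 / N\<close>, so multiplying
  the equation by \<open>N\<close> exchanges the outer coefficients. The clause for
  \<open>None\<close> in \<open>quadric\<close> is what makes this hold for the swapped pair
  \<open>p\<close> and infinity as well.\<close>

lemma inversion_in_quadric_iff:
  "inversion (Some p) z \<in> quadric p \<gamma> v \<alpha> \<longleftrightarrow> z \<in> quadric p \<alpha> v \<gamma>"
proof (cases z)
  case (Some x)
  show ?thesis
  proof (cases "x = p")
    case False
    define N where "N = (norm (x - p))\<^sup>2"
    have N: "N \<noteq> 0" using False by (simp add: N_def)
    have "(norm ((1 / N) *\<^sub>R (x - p)))\<^sup>2 = 1 / N"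
      using N by (simp add: power_mult_distrib power_divide flip: N_def) (simp add: power2_eq_square)
    then have "inversion (Some p) z \<in> quadric p \<gamma> v \<alpha> \<longleftrightarrow> \<gamma> / N + v \<bullet> (x - p) / N + \<alpha> = 0"
      using False Some by (simp add: quadric_def flip: N_def)
    also have "\<dots> \<longleftrightarrow> z \<in> quadric p \<alpha> v \<gamma>"
      using N Some by (simp add: quadric_def field_simps flip: N_def)
    finally show ?thesis .
  qed (simp add: Some quadric_def)
qed (simp add: quadric_def)

text \<open>The discriminant condition is symmetric in \<alpha> and \<gamma>, so it survives their
  exchange. Images may be treated as preimages because inversion is an involution.\<close>

lemma gsphere_inversion:
  assumes "gsphere A"
  shows "gsphere (inversion q ` A)"
proof (cases q)
  case (Some p)
  obtain \<alpha> v \<gamma> where *: "4 * \<alpha> * \<gamma> < v \<bullet> v" "A = quadric p \<alpha> v \<gamma>"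
    using assms gsphere_iff_quadric by blast
  have "z \<in> inversion q ` A \<longleftrightarrow> inversion q z \<in> A" for z
    by (metis image_iff inversion_inversion)
  also have "\<dots> z \<longleftrightarrow> z \<in> quadric p \<gamma> v \<alpha>" for z
    unfolding *(2) Some by (rule inversion_in_quadric_iff)
  finally have "inversion q ` A = quadric p \<gamma> v \<alpha>" by blast
  moreover have "4 * \<gamma> * \<alpha> < v \<bullet> v" using *(1) by (simp add: mult_ac)
  ultimately show ?thesis unfolding gsphere_iff_quadric[of _ p] by blast
next
  case None
  then have "inversion q = id" by auto
  then show ?thesis using assms by simp
qed

section \<open>Scaling\<close>

lemma image_scaleR_ehyperplane:
  assumes "0 < k"
  shows "map_option ((*\<^sub>R) k) ` ehyperplane a b = ehyperplane a (k * b)"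
proof -
  have "x \<in> (*\<^sub>R) k ` {x. a \<bullet> x = b} \<longleftrightarrow> a \<bullet> x = k * b" for x
    using assms by (auto simp: image_iff intro!: exI[of _ "(1 / k) *\<^sub>R x"])
  then have "{x. a \<bullet> x = k * b} = (*\<^sub>R) k ` {x. a \<bullet> x = b}" by blast
  then show ?thesis
    by (simp add: ehyperplane_def image_image)
qed

lemma image_scaleR_esphere:
  assumes "0 < k"
  shows "map_option ((*\<^sub>R) k) ` esphere c r = esphere (k *\<^sub>R c) (k * r)"
proof -
  have "sphere (k *\<^sub>R c) (k * r) = (*\<^sub>R) k ` sphere c r"
    using sphere_scale[of k c r] assms by simp
  then show ?thesis
    by (simp add: esphere_def image_image)
qed

lemma gsphere_scaleR:
  "0 < k \<Longrightarrow> gsphere A \<Longrightarrow> gsphere (map_option ((*\<^sub>R) k) ` A)"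
  using image_scaleR_ehyperplane[of k] image_scaleR_esphere[of k] mult_pos_pos[of k]
  unfolding gsphere_def by blast

section \<open>Tangency in terms of distances\<close>

text \<open>Reflecting the hyperplane in the foot of the perpendicular from \<open>c\<close>
  preserves the intersection, so a unique common point must be that foot. Conversely, Pythagoras
  leaves only the foot when its distance from \<open>c\<close> is \<open>r\<close>.\<close>

lemma tangent_ehyperplane_esphere_iff:
  assumes "norm a = 1" "0 < r"
  shows "tangent (ehyperplane a b) (esphere c r) \<longleftrightarrow> \<bar>a \<bullet> c - b\<bar> = r"
proof -
  \<comment> \<open>The foot of the perpendicular from \<open>c\<close> to the hyperplane.\<close>
  define f where "f = c + (b - a \<bullet> c) *\<^sub>R a"
  have aa: "a \<bullet> a = 1" using assms(1) by (simp add: norm_eq_1)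
  have af: "a \<bullet> f = b" by (simp add: f_def inner_add aa)
  have df: "dist c f = \<bar>a \<bullet> c - b\<bar>" using assms(1) by (simp add: f_def dist_norm)
  have pyth: "(dist c x)\<^sup>2 = (norm (x - f))\<^sup>2 + (a \<bullet> c - b)\<^sup>2" if "a \<bullet> x = b" for x
  proof -
    have "dist c x = norm ((x - f) + (b - a \<bullet> c) *\<^sub>R a)"
      by (simp add: f_def dist_norm norm_minus_commute)
    moreover have "orthogonal (x - f) ((b - a \<bullet> c) *\<^sub>R a)"
      using that af by (simp add: orthogonal_def inner_diff_right inner_commute[of _ a])
    ultimately show ?thesis
      using assms(1) by (simp add: norm_add_Pythagorean power2_commute)
  qed
  have inter: "ehyperplane a b \<inter> esphere c r = Some ` {x. a \<bullet> x = b \<and> dist c x = r}"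
    by (auto simp: ehyperplane_def esphere_def)
  show ?thesis
  proof
    assume "tangent (ehyperplane a b) (esphere c r)"
    then obtain q where q: "Some ` {x. a \<bullet> x = b \<and> dist c x = r} = {q}"
      unfolding tangent_def inter by (elim exE)
    then have "q \<in> Some ` {x. a \<bullet> x = b \<and> dist c x = r}" by simp
    then obtain x where "q = Some x" by (rule imageE)
    with q have "Some ` {x. a \<bullet> x = b \<and> dist c x = r} = Some ` {x}" by simp
    then have x: "{x. a \<bullet> x = b \<and> dist c x = r} = {x}"
      unfolding inj_image_eq_iff[OF inj_Some] .
    \<comment> \<open>The mirror image of \<open>x\<close> in \<open>f\<close>; it is again a common
      point.\<close>
    define y where "y = 2 *\<^sub>R f - x"
    have iff: "a \<bullet> w = b \<and> dist c w = r \<longleftrightarrow> w = x" for w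
      using x unfolding set_eq_iff by simp
    have "a \<bullet> x = b" "dist c x = r" using iff[of x] by simp_all
    moreover have "a \<bullet> y = b" using af \<open>a \<bullet> x = b\<close> by (simp add: y_def inner_diff)
    moreover have "y - f = - (x - f)" by (simp add: y_def scaleR_2)
    then have "norm (y - f) = norm (x - f)" by (simp only: norm_minus_cancel)
    ultimately have "(dist c y)\<^sup>2 = r\<^sup>2" using pyth by metis
    then have "dist c y = r" using assms(2) by (simp add: power2_eq_iff_nonneg)
    then have "y = x" using iff \<open>a \<bullet> y = b\<close> by blast
    then have "2 *\<^sub>R f = 2 *\<^sub>R x" by (simp add: y_def scaleR_2 diff_eq_eq)
    then have "x = f" by simp
    then show "\<bar>a \<bullet> c - b\<bar> = r" using df \<open>dist c x = r\<close> by simp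
  next
    assume r: "\<bar>a \<bullet> c - b\<bar> = r"
    have "x = f" if "a \<bullet> x = b" "dist c x = r" for x
    proof -
      have "(norm (x - f))\<^sup>2 = 0" using pyth[OF that(1)] that(2) r power2_abs[of "a \<bullet> c - b"] by simp
      then show ?thesis by simp
    qed
    then have "{x. a \<bullet> x = b \<and> dist c x = r} = {f}" using af df r by blast
    then have "ehyperplane a b \<inter> esphere c r = {Some f}" unfolding inter by simp
    then show "tangent (ehyperplane a b) (esphere c r)" unfolding tangent_def by (rule exI)
  qed
qed

lemma esphere_1_inter_esphere_1:
  assumes "2 \<le> dist c c'"
  shows "esphere c 1 \<inter> esphere c' 1 = (if dist c c' = 2 then {Some (midpoint c c')} else {})"
proof -
  \<comment> \<open>The median identity in the triangle \<open>c\<close>, \<open>c'\<close>,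
    \<open>x\<close>. With both distances 1 and \<open>dist c c' = 2\<close> it leaves no room
    between \<open>x\<close> and the midpoint.\<close>
  have par: "(dist c x)\<^sup>2 + (dist c' x)\<^sup>2 = 2 * (norm (x - midpoint c c'))\<^sup>2 + (dist c c')\<^sup>2 / 2" for x
    by (simp add: dist_norm power2_norm_eq_inner midpoint_def inner_add inner_diff inner_commute field_simps)
  have "dist c c' = 2 \<and> x = midpoint c c'" if "dist c x = 1" "dist c' x = 1" for x
  proof -
    have "dist c c' \<le> 2" using dist_triangle[of c c' x] that by (simp add: dist_commute)
    then show ?thesis using par[of x] assms that by simp
  qed
  moreover have "dist c (midpoint c c') = 1" "dist c' (midpoint c c') = 1" if "dist c c' = 2"
    using that by (simp_all add: dist_midpoint)
  ultimately have "{x. dist c x = 1 \<and> dist c' x = 1} = (if dist c c' = 2 then {midpoint c c'} else {})"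
    by auto
  moreover have "esphere c 1 \<inter> esphere c' 1 = Some ` {x. dist c x = 1 \<and> dist c' x = 1}"
    by (auto simp: esphere_def)
  ultimately show ?thesis by simp
qed

text \<open>The point reflection about the midpoint of the centres swaps the two unit spheres, so it
  fixes a unique common point, which is then the midpoint at distance 1 from both centres. This also
  shows that a unit sphere is not tangent to itself.\<close>

lemma tangent_esphere_1_iff:
  "tangent (esphere c 1) (esphere c' 1) \<longleftrightarrow> dist c c' = 2"
proof
  assume "tangent (esphere c 1) (esphere c' 1)"
  then obtain p where p: "esphere c 1 \<inter> esphere c' 1 = {p}" unfolding tangent_def by blast
  then have "p \<in> esphere c 1" "p \<in> esphere c' 1" by blast+
  then obtain x where x: "p = Some x" "dist c x = 1" "dist c' x = 1"
    by (cases p) simp_all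
  have "c - (c + c' - x) = x - c'" "c' - (c + c' - x) = x - c" by simp_all
  then have "Some (c + c' - x) \<in> esphere c 1 \<inter> esphere c' 1"
    using x(2,3) unfolding dist_norm Int_iff Some_in_esphere_iff by (metis norm_minus_commute)
  then have "Some (c + c' - x) = Some x" unfolding p x(1) by (rule singletonD)
  then have mid: "c + c' - x = x" by (rule option.inject[THEN iffD1])
  have "c' - c = ((c + c' - x) - c) + (x - c)" by simp
  also have "\<dots> = 2 *\<^sub>R (x - c)" unfolding mid by (rule scaleR_2[symmetric])
  finally have "norm (c' - c) = 2 * norm (x - c)" by simp
  then show "dist c c' = 2"
    using x(2) unfolding dist_norm by (metis norm_minus_commute mult.right_neutral)
next
  assume *: "dist c c' = 2"
  then have "esphere c 1 \<inter> esphere c' 1 = {Some (midpoint c c')}"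
    unfolding esphere_1_inter_esphere_1[OF eq_refl[OF *[symmetric]]] by (rule if_P)
  then show "tangent (esphere c 1) (esphere c' 1)"
    unfolding tangent_def by blast
qed

lemma non_intersecting_esphere_1:
  "2 \<le> dist c c' \<Longrightarrow> non_intersecting (esphere c 1) (esphere c' 1)"
  using esphere_1_inter_esphere_1[of c c'] by (simp add: non_intersecting_def tangent_def)

section \<open>Parallel hyperplanes and their midplane\<close>

text \<open>If \<open>a'\<close> had a nonzero component \<open>w\<close> orthogonal to
  \<open>a\<close>, moving along \<open>w\<close> would keep the first equation while solving the
  second, which gives a finite common point.\<close>

lemma ehyperplane_inter_eq_NoneD:
  assumes "a \<noteq> 0" "a' \<noteq> 0" "ehyperplane a b \<inter> ehyperplane a' b' = {None}"
  obtains t where "t \<noteq> 0" "a' = t *\<^sub>R a"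
proof -
  define t where "t = (a' \<bullet> a) / (a \<bullet> a)"
  define w where "w = a' - t *\<^sub>R a"
  have wa: "a \<bullet> w = 0" using assms(1) by (simp add: w_def t_def inner_diff inner_commute)
  have "w = 0"
  proof (rule ccontr)
    assume "w \<noteq> 0"
    have "a' \<bullet> w = w \<bullet> w"
      using wa by (simp add: w_def inner_diff inner_commute)
    define x where "x = (b / (a \<bullet> a)) *\<^sub>R a"
    define y where "y = x + ((b' - a' \<bullet> x) / (w \<bullet> w)) *\<^sub>R w"
    have "a \<bullet> y = b" using wa assms(1) by (simp add: y_def x_def inner_add)
    moreover have "a' \<bullet> y = b'" using \<open>a' \<bullet> w = w \<bullet> w\<close> \<open>w \<noteq> 0\<close> by (simp add: y_def inner_add)
    ultimately have "Some y \<in> ehyperplane a b \<inter> ehyperplane a' b'" by simp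
    then show False using assms(3) by simp
  qed
  then have "a' = t *\<^sub>R a" by (simp add: w_def)
  moreover have "t \<noteq> 0" using calculation assms(2) by auto
  ultimately show ?thesis using that by blast
qed

text \<open>\<open>midplane\<close> quantifies over all equations of the two hyperplanes, so
  independence of the chosen one is at stake. It follows from describing the midplane as the set of
  midpoints between points of the two hyperplanes, which mentions the point sets only.\<close>

lemma midplane_ehyperplane:
  assumes "a \<noteq> 0"
  shows "midplane (ehyperplane a b) (ehyperplane a c) = {x. a \<bullet> x = (b + c) / 2}"
proof -
  have mid: "a \<bullet> x = (b + c) / 2 \<longleftrightarrow>
      (\<exists>u v. Some u \<in> ehyperplane a b \<and> Some v \<in> ehyperplane a c \<and> x = (1 / 2) *\<^sub>R (u + v))"
    if "a \<noteq> 0" for a x :: 'a and b c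
  proof
    assume x: "a \<bullet> x = (b + c) / 2"
    define u where "u = (b / (a \<bullet> a)) *\<^sub>R a"
    have "a \<bullet> u = b" using that by (simp add: u_def)
    moreover have "a \<bullet> (2 *\<^sub>R x - u) = c" using x \<open>a \<bullet> u = b\<close> by (simp add: inner_diff)
    ultimately show "\<exists>u v. Some u \<in> ehyperplane a b \<and> Some v \<in> ehyperplane a c \<and> x = (1 / 2) *\<^sub>R (u + v)"
      by (intro exI[of _ u] exI[of _ "2 *\<^sub>R x - u"]) (simp add: ehyperplane_def)
  qed (auto simp: ehyperplane_def inner_add)
  have "x \<in> midplane (ehyperplane a b) (ehyperplane a c) \<longleftrightarrow> a \<bullet> x = (b + c) / 2" for x
  proof
    assume "x \<in> midplane (ehyperplane a b) (ehyperplane a c)"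
    then obtain a' b' c' where *: "a' \<noteq> 0" "ehyperplane a b = ehyperplane a' b'"
        "ehyperplane a c = ehyperplane a' c'" "a' \<bullet> x = (b' + c') / 2"
      unfolding midplane_def by blast
    show "a \<bullet> x = (b + c) / 2"
      using *(4) unfolding mid[OF *(1)] mid[OF assms] *(2,3) .
  next
    assume "a \<bullet> x = (b + c) / 2"
    then show "x \<in> midplane (ehyperplane a b) (ehyperplane a c)"
      unfolding midplane_def using assms by blast
  qed
  then show ?thesis by blast
qed

lemma enlarged_sphere_esphere:
  "0 < r \<Longrightarrow> enlarged_sphere (esphere c r) = sphere c (r + 1)"
  unfolding enlarged_sphere_def by (simp add: esphere_eq_iff sphere_def cong: conj_cong)

section \<open>The regular simplex and the sphere equidistant from its vertices\<close>

text \<open>Since the vectors sum to zero, adding the squared distances from a fixed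
  \<open>w i\<close> cancels the mixed terms and ties its squared norm to the total
  \<open>s\<close>. A second summation determines \<open>s\<close>, hence the diagonal, and
  polarization gives the other entries.\<close>

lemma simplex_gram:
  fixes w :: "'i \<Rightarrow> 'a::real_inner"
  assumes "finite I" "(\<Sum>i\<in>I. w i) = 0"
    and "\<And>i j. i \<in> I \<Longrightarrow> j \<in> I \<Longrightarrow> i \<noteq> j \<Longrightarrow> (w i - w j) \<bullet> (w i - w j) = 4"
    and "i \<in> I" "j \<in> I"
  shows "w i \<bullet> w j = (if i = j then 2 else 0) - 2 / card I"
proof -
  define s where "s = (\<Sum>j\<in>I. w j \<bullet> w j)"
  have k: "card I > 0" using assms(1,4) card_gt_0_iff by blast
  have row: "card I * (w i \<bullet> w i) + s = 4 * (real (card I) - 1)" if "i \<in> I" for i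
  proof -
    have "(\<Sum>j\<in>I. (w i - w j) \<bullet> (w i - w j)) = (\<Sum>j\<in>I. if j = i then 0 else 4)"
      using assms(3) that by (intro sum.cong) auto
    also have "\<dots> = (\<Sum>j\<in>I. 4 - (if j = i then 4 else 0))"
      by (intro sum.cong) auto
    also have "\<dots> = 4 * (real (card I) - 1)"
      using assms(1) that by (simp add: sum_subtractf)
    finally have "(\<Sum>j\<in>I. (w i - w j) \<bullet> (w i - w j)) = 4 * (real (card I) - 1)" .
    moreover have "(w i - w j) \<bullet> (w i - w j) = w i \<bullet> w i - 2 * (w i \<bullet> w j) + w j \<bullet> w j" for j
      by (simp add: inner_diff inner_commute)
    moreover have "(\<Sum>j\<in>I. w i \<bullet> w j) = 0"
      using assms(2) by (simp flip: inner_sum_right)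
    ultimately show ?thesis
      by (simp add: sum.distrib sum_subtractf s_def flip: sum_distrib_left)
  qed
  have "(\<Sum>i\<in>I. card I * (w i \<bullet> w i) + s) = (\<Sum>i\<in>I. 4 * (real (card I) - 1))"
    using row by (intro sum.cong) auto
  then have "card I * (2 * s) = card I * (4 * (real (card I) - 1))"
    by (simp add: sum.distrib flip: sum_distrib_left s_def)
  then have "s = 2 * (real (card I) - 1)" using k by simp
  then have diag: "w i \<bullet> w i = 2 - 2 / card I" if "i \<in> I" for i
    using row[OF that] k by (simp add: field_simps)
  show ?thesis
  proof (cases "i = j")
    case False
    have "(w i - w j) \<bullet> (w i - w j) = w i \<bullet> w i - 2 * (w i \<bullet> w j) + w j \<bullet> w j"
      by (simp add: inner_diff inner_commute)
    then show ?thesis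
      using assms(3)[of i j] assms(4,5) diag[of i] diag[of j] False by simp
  qed (use diag assms in simp)
qed

text \<open>Relative to the centroid \<open>z\<close>, each condition of distance 2 becomes linear
  in \<open>w i\<close> with a right-hand side common to all vertices. Summing over the vertices
  makes that side zero, so the locus is a sphere in the orthogonal complement of \<open>a\<close>
  and all \<open>w i\<close>. That complement has the dimension of \<open>'b\<close>.\<close>

lemma simplex_locus:
  fixes a :: "'a::euclidean_space" and c :: "'i \<Rightarrow> 'a"
  assumes "norm a = 1" "finite I" "I \<noteq> {}"
    and height: "\<And>i. i \<in> I \<Longrightarrow> a \<bullet> c i = h"
    and edge: "\<And>i j. i \<in> I \<Longrightarrow> j \<in> I \<Longrightarrow> i \<noteq> j \<Longrightarrow> dist (c i) (c j) = 2"
    and dim: "DIM('b::euclidean_space) + card I = DIM('a)"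
  obtains z and e :: "'b::euclidean_space \<Rightarrow> 'a"
  where "linear e" "\<And>v. norm (e v) = norm v"
    "{x. a \<bullet> x = h} \<inter> (\<Inter>i\<in>I. sphere (c i) 2) =
     (\<lambda>u. z + sqrt (2 * (real (card I) + 1) / real (card I)) *\<^sub>R e u) ` sphere 0 1"
proof -
  define k where "k = real (card I)"
  have k: "k > 0" using assms(2,3) by (simp add: k_def card_gt_0_iff)
  \<comment> \<open>The squared radius \<open>2 + 2 / k\<close> is the squared edge 4 minus the
    squared circumradius \<open>2 - 2 / k\<close> of the simplex.\<close>
  define R where "R = sqrt (2 * (k + 1) / k)"
  have R: "R > 0" "R\<^sup>2 = 2 + 2 / k" using k by (simp_all add: R_def field_simps)
  define z where "z = (1 / k) *\<^sub>R (\<Sum>i\<in>I. c i)"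
  define w where "w = (\<lambda>i. c i - z)"
  have sum_w: "(\<Sum>i\<in>I. w i) = 0"
    using k by (simp add: w_def sum_subtractf z_def k_def scaleR_right_diff_distrib sum_constant_scaleR)
  have az: "a \<bullet> z = h"
    using k height by (simp add: z_def inner_sum_right k_def)
  have aw: "a \<bullet> w i = 0" if "i \<in> I" for i
    using height[OF that] az by (simp add: w_def inner_diff)
  have aa: "a \<bullet> a = 1" using assms(1) by (simp add: norm_eq_1)
  have "(w i - w j) \<bullet> (w i - w j) = 4" if "i \<in> I" "j \<in> I" "i \<noteq> j" for i j
    using edge[OF that] by (simp add: w_def dist_norm flip: power2_norm_eq_inner)
  then have gram: "w i \<bullet> w j = (if i = j then 2 else 0) - 2 / k" if "i \<in> I" "j \<in> I" for i j
    using simplex_gram[OF assms(2) sum_w _ that] by (simp add: k_def)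
  \<comment> \<open>The square of \<open>t\<close> cancels the term \<open>- 2 / k\<close> of the
    Gram matrix.\<close>
  define t where "t = sqrt (2 / k)"
  have t: "t * t = 2 / k" "t \<noteq> 0" using k by (simp_all add: t_def)
  \<comment> \<open>Lifting the vertices by \<open>t\<close> along the normal \<open>a\<close> makes them orthogonal.\<close>
  define u where "u = (\<lambda>i. w i + t *\<^sub>R a)"
  have u: "u i \<bullet> u j = (if i = j then 2 else 0)" if "i \<in> I" "j \<in> I" for i j
    using gram[OF that] aw[OF that(1)] aw[OF that(2)] t(1) aa
    by (simp add: u_def inner_add inner_commute)
  have inj: "inj_on u I"
    by (rule inj_onI) (metis u zero_neq_numeral)
  \<comment> \<open>The \<open>w i\<close> themselves are dependent, as they sum to zero. The lifted
    vectors have the same span as \<open>a\<close> together with all \<open>w i\<close>, and their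
    number gives its dimension.\<close>
  have "independent (u ` I)"
  proof (rule pairwise_orthogonal_independent)
    show "pairwise orthogonal (u ` I)" using u by (auto simp: pairwise_def orthogonal_def)
    show "0 \<notin> u ` I" using u by force
  qed
  then have "dim (span (u ` I)) = card I"
    using inj by (simp add: dim_eq_card_independent card_image)
  define V where "V = {y. \<forall>x\<in>span (u ` I). orthogonal x y}"
  have V: "subspace V" unfolding V_def by (rule subspace_orthogonal_to_vectors)
  have "dim V + dim (span (u ` I)) = DIM('a)"
    using dim_subspace_orthogonal_to_vectors[of "span (u ` I)" UNIV]
    unfolding V_def by simp
  then have "dim (UNIV :: 'b set) = dim V"
    using dim \<open>dim (span (u ` I)) = card I\<close> by simp
  then obtain e :: "'b \<Rightarrow> 'a" and g where e: "linear e" "e ` UNIV = V" "\<And>v. norm (e v) = norm v"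
    by (rule isometries_subspaces[OF subspace_UNIV V]) auto
  have in_V: "y \<in> V \<longleftrightarrow> a \<bullet> y = 0 \<and> (\<forall>i\<in>I. w i \<bullet> y = 0)" for y
  proof -
    have "y \<in> V \<longleftrightarrow> (\<forall>i\<in>I. u i \<bullet> y = 0)"
    proof
      assume *: "\<forall>i\<in>I. u i \<bullet> y = 0"
      have "orthogonal y x" if "x \<in> span (u ` I)" for x
        by (rule orthogonal_to_span[OF that]) (use * in \<open>auto simp: orthogonal_def inner_commute\<close>)
      then show "y \<in> V" by (simp add: V_def orthogonal_commute)
    qed (auto simp: V_def orthogonal_def span_base)
    also have "\<dots> \<longleftrightarrow> a \<bullet> y = 0 \<and> (\<forall>i\<in>I. w i \<bullet> y = 0)"
    proof
      assume *: "\<forall>i\<in>I. u i \<bullet> y = 0"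
      \<comment> \<open>Summation removes the \<open>w i\<close> and isolates \<open>a\<close>, so
        orthogonality to all \<open>u i\<close> splits into orthogonality to \<open>a\<close> and to
        each \<open>w i\<close>.\<close>
      have "(\<Sum>i\<in>I. u i) = (k * t) *\<^sub>R a"
        by (simp add: u_def sum.distrib sum_w k_def sum_constant_scaleR)
      moreover have "(\<Sum>i\<in>I. u i) \<bullet> y = 0" using * by (simp add: inner_sum_left)
      ultimately have "a \<bullet> y = 0" using k t by simp
      then show "a \<bullet> y = 0 \<and> (\<forall>i\<in>I. w i \<bullet> y = 0)" using * by (simp add: u_def inner_add)
    qed (simp add: u_def inner_add)
    finally show ?thesis .
  qed
  have locus: "z + y \<in> {x. a \<bullet> x = h} \<inter> (\<Inter>i\<in>I. sphere (c i) 2) \<longleftrightarrow> y \<in> V \<and> norm y = R" for y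
  proof -
    \<comment> \<open>The squared norm of \<open>w i\<close> is 4 minus the square of
      \<open>R\<close>, so the right-hand side does not depend on \<open>i\<close>.\<close>
    have "dist (c i) (z + y) = 2 \<longleftrightarrow> w i \<bullet> y = (y \<bullet> y - R\<^sup>2) / 2" if "i \<in> I" for i
    proof -
      have "dist (c i) (z + y) = 2 \<longleftrightarrow> (dist (c i) (z + y))\<^sup>2 = 2\<^sup>2"
        by (subst power2_eq_iff_nonneg) auto
      also have "(dist (c i) (z + y))\<^sup>2 = (w i - y) \<bullet> (w i - y)"
        by (simp add: dist_norm w_def power2_norm_eq_inner algebra_simps)
      also have "\<dots> = w i \<bullet> w i - 2 * (w i \<bullet> y) + y \<bullet> y"
        by (simp add: inner_diff inner_commute)
      finally show ?thesis using gram[OF that that] R(2) by auto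
    qed
    then have "z + y \<in> {x. a \<bullet> x = h} \<inter> (\<Inter>i\<in>I. sphere (c i) 2) \<longleftrightarrow>
        a \<bullet> y = 0 \<and> (\<forall>i\<in>I. w i \<bullet> y = (y \<bullet> y - R\<^sup>2) / 2)"
      using az by (auto simp: inner_add)
    also have "\<dots> \<longleftrightarrow> y \<in> V \<and> y \<bullet> y = R\<^sup>2"
    proof
      assume *: "a \<bullet> y = 0 \<and> (\<forall>i\<in>I. w i \<bullet> y = (y \<bullet> y - R\<^sup>2) / 2)"
      have "0 = (\<Sum>i\<in>I. w i) \<bullet> y" using sum_w by simp
      also have "\<dots> = (\<Sum>i\<in>I. (y \<bullet> y - R\<^sup>2) / 2)"
        unfolding inner_sum_left using * by (intro sum.cong) simp_all
      also have "\<dots> = k * ((y \<bullet> y - R\<^sup>2) / 2)" by (simp add: k_def)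
      finally have "y \<bullet> y = R\<^sup>2" using k by simp
      then show "y \<in> V \<and> y \<bullet> y = R\<^sup>2" using * in_V by simp
    qed (simp add: in_V)
    also have "y \<bullet> y = R\<^sup>2 \<longleftrightarrow> norm y = R"
      using R(1) by (simp add: power2_eq_iff_nonneg flip: power2_norm_eq_inner)
    finally show ?thesis .
  qed
  have "x \<in> {x. a \<bullet> x = h} \<inter> (\<Inter>i\<in>I. sphere (c i) 2) \<longleftrightarrow> x \<in> (\<lambda>u. z + R *\<^sub>R e u) ` sphere 0 1" for x
  proof -
    have "x - z \<in> V \<and> norm (x - z) = R \<longleftrightarrow> (\<exists>v. norm v = 1 \<and> x - z = R *\<^sub>R e v)"
    proof
      assume *: "x - z \<in> V \<and> norm (x - z) = R"
      then obtain v where v: "x - z = e v" using e(2) by blast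
      then have "norm ((1 / R) *\<^sub>R v) = 1" using * e(3)[of v] R(1) by simp
      moreover have "x - z = R *\<^sub>R e ((1 / R) *\<^sub>R v)"
        using v R(1) by (simp add: linear_scale[OF e(1)])
      ultimately show "\<exists>v. norm v = 1 \<and> x - z = R *\<^sub>R e v" by blast
    next
      assume "\<exists>v. norm v = 1 \<and> x - z = R *\<^sub>R e v"
      then obtain v where "norm v = 1" "x - z = R *\<^sub>R e v" by blast
      then show "x - z \<in> V \<and> norm (x - z) = R"
        using e(2,3) V R(1) by (auto intro: subspace_scale)
    qed
    then show ?thesis
      using locus[of "x - z"] by (auto simp: image_iff algebra_simps)
  qed
  then have "{x. a \<bullet> x = h} \<inter> (\<Inter>i\<in>I. sphere (c i) 2) = (\<lambda>u. z + R *\<^sub>R e u) ` sphere 0 1"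
    by (rule set_eqI)
  then show ?thesis
    unfolding R_def k_def by (rule that[OF e(1,3)])
qed

text \<open>
  The diameter determines the radius, so it does not depend on the chosen identification.
\<close>

lemma isometric_sphere_radius_le:
  fixes e :: "'b::euclidean_space \<Rightarrow> 'a::euclidean_space" and e' :: "'c::euclidean_space \<Rightarrow> 'a"
  assumes "linear e" "\<And>v. norm (e v) = norm v" "\<And>v. norm (e' v) = norm v" "0 < R'"
    and "(\<lambda>u. z + R *\<^sub>R e u) ` sphere 0 1 \<subseteq> (\<lambda>u. z' + R' *\<^sub>R e' u) ` sphere 0 1"
  shows "R \<le> R'"
proof -
  obtain v :: 'b where v: "norm v = 1" using vector_choose_size[of 1] by auto
  have "z + R *\<^sub>R e v \<in> (\<lambda>u. z' + R' *\<^sub>R e' u) ` sphere 0 1"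
    "z + R *\<^sub>R e (- v) \<in> (\<lambda>u. z' + R' *\<^sub>R e' u) ` sphere 0 1"
    using v by (auto intro!: subsetD[OF assms(5)])
  then obtain x y where xy: "norm x = 1" "norm y = 1"
    "z + R *\<^sub>R e v = z' + R' *\<^sub>R e' x" "z + R *\<^sub>R e (- v) = z' + R' *\<^sub>R e' y"
    by auto
  have "(2 * R) *\<^sub>R e v = (z + R *\<^sub>R e v) - (z + R *\<^sub>R e (- v))"
    by (simp add: linear_neg[OF assms(1)] scaleR_2 flip: scaleR_scaleR)
  also have "\<dots> = R' *\<^sub>R e' x - R' *\<^sub>R e' y" using xy by simp
  finally have "norm ((2 * R) *\<^sub>R e v) \<le> norm (R' *\<^sub>R e' x) + norm (R' *\<^sub>R e' y)"
    using norm_triangle_ineq4 by metis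
  then show ?thesis using assms v xy by simp
qed

section \<open>Transport along scaled inversions\<close>

context
  fixes q :: "'a::euclidean_space option" and k :: real and T
  assumes k: "0 < k" and T: "T = map_option ((*\<^sub>R) k) \<circ> inversion q"
begin

lemma bij_scaled_inversion: "bij T"
proof -
  have "map_option ((*\<^sub>R) (1 / k)) \<circ> map_option ((*\<^sub>R) k) = (id :: 'a option \<Rightarrow> _)"
    "map_option ((*\<^sub>R) k) \<circ> map_option ((*\<^sub>R) (1 / k)) = (id :: 'a option \<Rightarrow> _)"
    using k by (auto simp: fun_eq_iff option.map_comp o_def option.map_ident)
  then have "bij (map_option ((*\<^sub>R) k) :: 'a option \<Rightarrow> _)" by (rule o_bij)
  moreover have "bij (inversion q)" by (rule o_bij[of "inversion q"]) (auto simp: fun_eq_iff)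
  ultimately show ?thesis unfolding T by (rule bij_comp[rotated])
qed

lemma gsphere_scaled_inversion_iff: "gsphere (T ` A) \<longleftrightarrow> gsphere A"
proof
  assume "gsphere (T ` A)"
  \<comment> \<open>Scaling by \<open>1 / k\<close> and inverting once more undoes
    \<open>T\<close>.\<close>
  then have "gsphere (inversion q ` map_option ((*\<^sub>R) (1 / k)) ` T ` A)"
    using k by (intro gsphere_inversion gsphere_scaleR) simp_all
  moreover have "inversion q (map_option ((*\<^sub>R) (1 / k)) (T z)) = z" for z
    using k by (simp add: T option.map_comp o_def option.map_ident)
  ultimately show "gsphere A" by (simp add: image_image)
next
  assume "gsphere A"
  then show "gsphere (T ` A)"
    unfolding T image_comp[symmetric] by (intro gsphere_inversion gsphere_scaleR k)
qed

end

text \<open>This decides which images are hyperplanes: those of the generalized spheres through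
  \<open>q\<close>. The case \<open>q = None\<close>, where the contact point is already at
  infinity, is covered because inversion is then the identity.\<close>

lemma scaled_inversion_center: "(map_option f \<circ> inversion q) q = None"
  by (cases q) auto

lemma tangent_image_iff:
  assumes "inj T"
  shows "tangent (T ` A) (T ` B) \<longleftrightarrow> tangent A B"
proof
  assume "tangent (T ` A) (T ` B)"
  then obtain p where p: "T ` (A \<inter> B) = {p}" using assms by (auto simp: tangent_def image_Int)
  then obtain x where "p = T x" by blast
  then have "T ` (A \<inter> B) = T ` {x}" using p by simp
  then show "tangent A B" unfolding tangent_def inj_image_eq_iff[OF assms] by blast
next
  assume "tangent A B"
  then show "tangent (T ` A) (T ` B)"
    unfolding tangent_def by (metis assms image_Int image_empty image_insert)
qed

lemma non_intersecting_image_iff: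
  "inj T \<Longrightarrow> non_intersecting (T ` A) (T ` B) \<longleftrightarrow> non_intersecting A B"
  by (simp add: non_intersecting_def tangent_image_iff flip: image_Int)

section \<open>Normal form of a mutually tangent family\<close>

text \<open>With the contact point sent to infinity, the two images are hyperplanes that meet only
  there, hence are parallel. What remains is to choose a common unit normal pointing from the first
  to the second, and to scale the gap to 2.\<close>

lemma normalization_exists:
  assumes "gsphere (S 1)" "gsphere (S 2)" "tangent (S 1) (S 2)"
  shows "\<exists>T. normalization S T"
proof -
  obtain q where q: "S 1 \<inter> S 2 = {q}" using assms(3) by (auto simp: tangent_def)
  let ?J = "inversion q"
  have inj: "inj ?J" by (rule injI) (metis inversion_inversion)
  have J: "?J ` S 1 \<inter> ?J ` S 2 = {None}"
    using q scaled_inversion_center[of id q] by (simp add: option.map_id flip: image_Int[OF inj])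
  have hyper: "\<exists>a b. a \<noteq> 0 \<and> A = ehyperplane a b" if "gsphere A" "None \<in> A" for A :: "'a option set"
    using that by (auto simp: gsphere_def esphere_def)
  have "None \<in> ?J ` S 1" "None \<in> ?J ` S 2" using J by blast+
  then obtain a b a' b' where H: "a \<noteq> 0" "?J ` S 1 = ehyperplane a b" "a' \<noteq> 0" "?J ` S 2 = ehyperplane a' b'"
    using hyper gsphere_inversion assms(1,2) by meson
  obtain s where s: "s \<noteq> 0" "a' = s *\<^sub>R a"
    using ehyperplane_inter_eq_NoneD[OF H(1,3)] J unfolding H by blast
  have *: "ehyperplane a' b' = ehyperplane a (b' / s)"
    using ehyperplane_scaleR[OF s(1), of a "b' / s"] s by simp
  \<comment> \<open>Coinciding hyperplanes would share a finite point, whereas the images meet only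
    at infinity.\<close>
  have "b \<noteq> b' / s"
  proof
    assume "b = b' / s"
    then have "ehyperplane a b = {None}" using J unfolding H * by simp
    moreover have "Some ((b / (a \<bullet> a)) *\<^sub>R a) \<in> ehyperplane a b" using H(1) by (simp add: ehyperplane_def)
    ultimately show False by simp
  qed
  \<comment> \<open>Division by \<open>norm a\<close> makes the normal a unit vector; the sign puts
    the image of \<open>S 2\<close> on its positive side.\<close>
  define r where "r = sgn (b' / s - b) / norm a"
  define \<beta> where "\<beta> = r * b"
  define \<gamma> where "\<gamma> = r * (b' / s)"
  have r: "r \<noteq> 0" "norm (r *\<^sub>R a) = 1"
    using \<open>b \<noteq> b' / s\<close> H(1) by (simp_all add: r_def abs_sgn_eq sgn_zero_iff)
  have "\<gamma> - \<beta> = r * (b' / s - b)" by (simp only: \<beta>_def \<gamma>_def right_diff_distrib)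
  also have "\<dots> = \<bar>b' / s - b\<bar> / norm a"
    by (simp only: r_def abs_sgn times_divide_eq_left times_divide_eq_right mult.commute)
  finally have "\<beta> < \<gamma>" using \<open>b \<noteq> b' / s\<close> H(1) by (smt (verit) divide_pos_pos zero_less_norm_iff)
  define k where "k = 2 / (\<gamma> - \<beta>)"
  have k: "k > 0" using \<open>\<beta> < \<gamma>\<close> by (simp add: k_def)
  let ?T = "map_option ((*\<^sub>R) k) \<circ> ?J"
  have "?T ` S 1 = ehyperplane (r *\<^sub>R a) (k * \<beta>)" "?T ` S 2 = ehyperplane (r *\<^sub>R a) (k * \<gamma>)"
    unfolding image_comp[symmetric] H * \<beta>_def \<gamma>_def
    using image_scaleR_ehyperplane[OF k] ehyperplane_scaleR[OF r(1), of a] by metis+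
  moreover have "k * \<gamma> = k * \<beta> + 2"
    using \<open>\<beta> < \<gamma>\<close> by (simp add: k_def field_simps)
  ultimately have "normalization S ?T"
    unfolding normalization_def using q k r(2) by metis
  then show ?thesis by blast
qed

text \<open>Distinct contact points keep the other members away from the centre of inversion, so
  their images remain bounded spheres. Touching two planes at distance 2 fixes the radius and the
  height of the centre, and mutual tangency gives the edge length.\<close>

lemma normalized_family:
  assumes "mutually_tangent m S" "3 \<le> m" "normalization S T"
  obtains a b c where
    "norm a = 1" "T ` S 1 = ehyperplane a b" "T ` S 2 = ehyperplane a (b + 2)"
    "\<And>i. i \<in> {3..m} \<Longrightarrow> T ` S i = esphere (c i) 1"
    "\<And>i. i \<in> {3..m} \<Longrightarrow> a \<bullet> c i = b + 1"
    "\<And>i j. i \<in> {3..m} \<Longrightarrow> j \<in> {3..m} \<Longrightarrow> i \<noteq> j \<Longrightarrow> dist (c i) (c j) = 2"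
proof -
  obtain q k a b where q: "S 1 \<inter> S 2 = {q}" and k: "0 < k" and T: "T = map_option ((*\<^sub>R) k) \<circ> inversion q"
    and ab: "norm a = 1" "T ` S 1 = ehyperplane a b" "T ` S 2 = ehyperplane a (b + 2)"
    using assms(3) unfolding normalization_def by blast
  have inj: "inj T" using bij_scaled_inversion[OF k T] by (rule bij_is_inj)
  have gs: "gsphere (T ` S i)" if "i \<in> {1..m}" for i
    using assms(1) that by (simp add: mutually_tangent_def gsphere_scaled_inversion_iff[OF k T])
  have tang: "tangent (T ` S i) (T ` S j)" if "i \<in> {1..m}" "j \<in> {1..m}" "i \<noteq> j" for i j
    using assms(1) that by (simp add: mutually_tangent_def tangent_image_iff[OF inj])
  have "\<exists>c. T ` S i = esphere c 1 \<and> a \<bullet> c = b + 1" if i: "i \<in> {3..m}" for i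
  proof -
    have "S 1 \<inter> S 2 \<inter> S i = {}"
      using assms(1) i unfolding mutually_tangent_def by force
    then have "q \<notin> S i" using q by blast
    then have "None \<notin> T ` S i"
      using inj scaled_inversion_center[of _ q] unfolding T by (metis inj_image_mem_iff)
    moreover have "gsphere (T ` S i)" using gs i by simp
    ultimately obtain c r where c: "0 < r" "T ` S i = esphere c r"
      unfolding gsphere_def ehyperplane_def by blast
    have "tangent (T ` S 1) (T ` S i)" "tangent (T ` S 2) (T ` S i)"
      using tang i assms(2) by simp_all
    then have "\<bar>a \<bullet> c - b\<bar> = r" "\<bar>a \<bullet> c - (b + 2)\<bar> = r"
      unfolding ab c by (simp_all only: tangent_ehyperplane_esphere_iff[OF ab(1) c(1)])
    \<comment> \<open>The numbers \<open>a \<bullet> c - b\<close> and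
      \<open>a \<bullet> c - b - 2\<close> have the same absolute value but differ by 2, so they are
      1 and -1.\<close>
    then have "a \<bullet> c = b + 1" "r = 1" using c(1) by linarith+
    then show ?thesis using c by blast
  qed
  then obtain c where c: "T ` S i = esphere (c i) 1" "a \<bullet> c i = b + 1" if "i \<in> {3..m}" for i
    by metis
  have "dist (c i) (c j) = 2" if "i \<in> {3..m}" "j \<in> {3..m}" "i \<noteq> j" for i j
    using tang[of i j] that c(1) by (simp add: tangent_esphere_1_iff)
  then show ?thesis using that ab c by blast
qed

lemma center_locus_eq:
  assumes "a \<noteq> 0" "T ` S 1 = ehyperplane a b" "T ` S 2 = ehyperplane a (b + 2)"
    "\<And>i. i \<in> {3..m} \<Longrightarrow> T ` S i = esphere (c i) 1"
  shows "center_locus m S T = {x. a \<bullet> x = b + 1} \<inter> (\<Inter>i\<in>{3..m}. sphere (c i) 2)"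
proof -
  have "(b + (b + 2)) / 2 = b + 1" by simp
  then have "midplane (T ` S 1) (T ` S 2) = {x. a \<bullet> x = b + 1}"
    unfolding assms(2,3) midplane_ehyperplane[OF assms(1)] by (simp only:)
  then show ?thesis
    using assms(4) by (simp add: center_locus_def enlarged_sphere_esphere)
qed

text \<open>The simplex has \<open>m - 2\<close> vertices, and together with the normal direction
  they take up \<open>m - 2\<close> dimensions. The radius is stated explicitly, although
  \<open>identification\<close> only asks for some positive one, because the conversion of angles
  into distances depends on its value.\<close>

lemma identification_exists:
  fixes S :: "nat \<Rightarrow> 'a::euclidean_space option set"
  assumes "mutually_tangent m S" "3 \<le> m" "normalization S T"
    and "DIM('b::euclidean_space) + m = DIM('a) + 2"
  obtains z and e :: "'b::euclidean_space \<Rightarrow> 'a" where "linear e" "\<And>v. norm (e v) = norm v"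
    "center_locus m S T = (\<lambda>u. z + sqrt (2 * (real m - 1) / (real m - 2)) *\<^sub>R e u) ` sphere 0 1"
proof -
  obtain a b c where *: "norm a = 1" "T ` S 1 = ehyperplane a b" "T ` S 2 = ehyperplane a (b + 2)"
    "\<And>i. i \<in> {3..m} \<Longrightarrow> T ` S i = esphere (c i) 1"
    "\<And>i. i \<in> {3..m} \<Longrightarrow> a \<bullet> c i = b + 1"
    "\<And>i j. i \<in> {3..m} \<Longrightarrow> j \<in> {3..m} \<Longrightarrow> i \<noteq> j \<Longrightarrow> dist (c i) (c j) = 2"
    by (rule normalized_family[OF assms(1-3)]) (rule that)
  have "a \<noteq> 0" using *(1) by auto
  have ne: "{3..m} \<noteq> {}" and dim: "DIM('b) + card {3..m} = DIM('a)" using assms(2,4) by auto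
  obtain z and e :: "'b \<Rightarrow> 'a" where e: "linear e" "\<And>v. norm (e v) = norm v"
    and "{x. a \<bullet> x = b + 1} \<inter> (\<Inter>i\<in>{3..m}. sphere (c i) 2) =
     (\<lambda>u. z + sqrt (2 * (real (card {3..m}) + 1) / real (card {3..m})) *\<^sub>R e u) ` sphere 0 1"
    by (rule simplex_locus[where c = c, OF *(1) finite_atLeastAtMost ne *(5,6) dim]) (assumption | rule that)+
  moreover have "center_locus m S T = {x. a \<bullet> x = b + 1} \<inter> (\<Inter>i\<in>{3..m}. sphere (c i) 2)"
    using \<open>a \<noteq> 0\<close> *(2-4) by (rule center_locus_eq)
  moreover have "real (card {3..m}) = real m - 2" "real (card {3..m}) + 1 = real m - 1"
    using assms(2) by simp_all
  ultimately show ?thesis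
    using that[OF e] by simp
qed

section \<open>Angles of code points and distances of centres\<close>

lemma centers_unit_spheres: "centers ((\<lambda>c. esphere c 1) ` Y) = Y"
  unfolding centers_def image_iff using zero_less_one by (auto simp only: esphere_eq_iff)

text \<open>A linear map preserving norms is injective, so \<open>inv_into\<close> is a genuine
  inverse here.\<close>

lemma central_projection_eq:
  assumes "linear e" "\<And>v. norm (e v) = norm v" "0 < R" "norm u = 1"
  shows "central_projection z e (z + R *\<^sub>R e u) = u"
proof -
  have "inj e" using assms(1,2) by (metis linear_injective_0 norm_eq_zero)
  then have "inj_on (\<lambda>u. z + e u) (sphere 0 1)" by (auto simp: inj_on_def)
  moreover have "z + (1 / norm (z + R *\<^sub>R e u - z)) *\<^sub>R (z + R *\<^sub>R e u - z) = z + e u"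
    using assms by simp
  ultimately show ?thesis
    using assms(4) inv_into_f_f[of "\<lambda>u. z + e u" "sphere 0 1" u]
    by (simp add: central_projection_def)
qed

lemma dist_isometric_sphere:
  assumes "linear e" "\<And>v. norm (e v) = norm v" "norm u = 1" "norm v = 1"
  shows "(dist (z + R *\<^sub>R e u) (z + R *\<^sub>R e v))\<^sup>2 = R\<^sup>2 * (2 - 2 * (u \<bullet> v))"
proof -
  have "dist (z + R *\<^sub>R e u) (z + R *\<^sub>R e v) = norm (R *\<^sub>R e (u - v))"
    by (simp add: dist_norm linear_diff[OF assms(1)] scaleR_diff_right)
  then have "(dist (z + R *\<^sub>R e u) (z + R *\<^sub>R e v))\<^sup>2 = R\<^sup>2 * ((u - v) \<bullet> (u - v))"
    by (simp add: assms(2) power_mult_distrib power2_norm_eq_inner)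
  then show ?thesis
    using assms(3,4) by (simp add: inner_diff inner_commute norm_eq_1)
qed

text \<open>The squared distance minus 4 is a positive multiple of
  \<open>1 / (real m - 1) - u \<bullet> v\<close>, and \<open>arccos\<close> reverses order. The
  code angle is thus exactly the one at which unit spheres on the locus touch.\<close>

lemma dist_kissing_sphere:
  assumes "linear e" "\<And>v. norm (e v) = norm v" "norm u = 1" "norm v = 1" "3 \<le> m"
    and "R = sqrt (2 * (real m - 1) / (real m - 2))"
  shows "2 \<le> dist (z + R *\<^sub>R e u) (z + R *\<^sub>R e v) \<longleftrightarrow> arccos (1 / (real m - 1)) \<le> angular_dist u v" (is ?A)
    and "dist (z + R *\<^sub>R e u) (z + R *\<^sub>R e v) = 2 \<longleftrightarrow> angular_dist u v = arccos (1 / (real m - 1))" (is ?B)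
proof -
  define D where "D = dist (z + R *\<^sub>R e u) (z + R *\<^sub>R e v)"
  have m: "real m \<ge> 3" using assms(5) by simp
  define A where "A = 2 * (real m - 1) / (real m - 2)"
  have A: "A > 0" using m by (simp add: A_def)
  \<comment> \<open>With \<open>A\<close> the squared radius, this identity is the source of the
    cosine \<open>1 / (real m - 1)\<close>.\<close>
  have "A - 2 = A * (1 / (real m - 1))"
  proof -
    define M N where "M = real m - 2" and "N = real m - 1"
    have "M \<noteq> 0" "N \<noteq> 0" "2 * N = 2 * M + 2" using m by (simp_all add: M_def N_def)
    then have "2 * N / M - 2 = 2 / M" by (simp add: add_divide_distrib)
    also have "\<dots> = 2 * N / M * (1 / N)" using \<open>N \<noteq> 0\<close> by simp
    finally show ?thesis unfolding A_def M_def N_def .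
  qed
  moreover have "D\<^sup>2 = A * (2 - 2 * (u \<bullet> v))"
    unfolding D_def dist_isometric_sphere[OF assms(1-4)] assms(6) A_def[symmetric] using A by simp
  moreover have "2 * A * (1 / (real m - 1) - u \<bullet> v) = 2 * (A * (1 / (real m - 1))) - 2 * A * (u \<bullet> v)"
    "A * (2 - 2 * (u \<bullet> v)) = 2 * A - 2 * A * (u \<bullet> v)"
    by (simp_all only: right_diff_distrib mult_ac)
  ultimately have D: "D\<^sup>2 - 2\<^sup>2 = 2 * A * (1 / (real m - 1) - u \<bullet> v)"
    by simp
  have pos: "2 * A > 0" using A by simp
  \<comment> \<open>\<open>arccos\<close> is compared only for arguments between -1 and 1.\<close>
  have uv: "\<bar>u \<bullet> v\<bar> \<le> 1" using Cauchy_Schwarz_ineq2[of u v] assms(3,4) by simp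
  have m1: "\<bar>1 / (real m - 1)\<bar> \<le> 1" using m by simp
  have "2 \<le> D \<longleftrightarrow> 0 \<le> D\<^sup>2 - 2\<^sup>2" using power_mono_iff[of 2 D 2] by (simp add: D_def)
  also have "\<dots> \<longleftrightarrow> u \<bullet> v \<le> 1 / (real m - 1)" unfolding D using pos by (simp only: zero_le_mult_iff) auto
  also have "\<dots> \<longleftrightarrow> arccos (1 / (real m - 1)) \<le> angular_dist u v"
    unfolding angular_dist_def using arccos_le_mono[OF m1 uv] by simp
  finally show ?A unfolding D_def .
  have "D = 2 \<longleftrightarrow> D\<^sup>2 - 2\<^sup>2 = 0" using power2_eq_iff_nonneg[of D 2] by (simp add: D_def)
  also have "\<dots> \<longleftrightarrow> u \<bullet> v = 1 / (real m - 1)" unfolding D using pos by (simp only: mult_eq_0_iff) auto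
  also have "\<dots> \<longleftrightarrow> angular_dist u v = arccos (1 / (real m - 1))"
    unfolding angular_dist_def using arccos_eq_iff[of "u \<bullet> v" "1 / (real m - 1)"] uv m1 by blast
  finally show ?B unfolding D_def .
qed

theorem theorem3p7:
  fixes S :: "nat \<Rightarrow> (real ^ 'n) option set"
    and X :: "(real ^ 'd) set"
    and m :: nat
  assumes "3 \<le> m" and "m < CARD('n) + 2"
    and "CARD('d) = CARD('n) + 2 - m"
    and "spherical_code (arccos (1 / (real m - 1))) X"
    and "mutually_tangent m S"
  shows "(\<exists>T z (e :: real ^ 'd \<Rightarrow> real ^ 'n).
            normalization S T \<and> identification (center_locus m S T) z e) \<and>
         (\<forall>T z (e :: real ^ 'd \<Rightarrow> real ^ 'n).
            normalization S T \<and> identification (center_locus m S T) z e \<longrightarrow>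
            (\<exists>P. tangent_to_all (S ` {1..m}) P \<and>
                 pairwise non_intersecting P \<and>
                 corresponds m S T z e P X \<and>
                 (kissing_arrangement (S ` {1..m}) P \<longleftrightarrow>
                    (\<forall>x\<in>X. \<exists>y\<in>X. angular_dist x y = arccos (1 / (real m - 1))))))"
proof (intro conjI allI impI)
  \<comment> \<open>Existence of a normalization and an identification ensures that the universal
    claim is not vacuous.\<close>
  have dim: "DIM(real ^ 'd) + m = DIM(real ^ 'n) + 2" using assms(2,3) by simp
  define R where "R = sqrt (2 * (real m - 1) / (real m - 2))"
  have R: "0 < R" using assms(1) by (simp add: R_def)
  have "gsphere (S 1)" "gsphere (S 2)" "tangent (S 1) (S 2)"
    using assms(1,5) by (simp_all add: mutually_tangent_def)
  then obtain T where "normalization S T" using normalization_exists by blast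
  note norm = this
  obtain z and e :: "real ^ 'd \<Rightarrow> real ^ 'n"
    where "linear e" "\<And>v. norm (e v) = norm v"
      "center_locus m S T = (\<lambda>u. z + R *\<^sub>R e u) ` sphere 0 1"
    by (rule identification_exists[OF assms(5,1) norm dim, folded R_def]) (rule that)
  then have "identification (center_locus m S T) z e"
    using R unfolding identification_def by (intro conjI allI exI[of _ R])
  with norm show "\<exists>T z (e :: real ^ 'd \<Rightarrow> real ^ 'n).
      normalization S T \<and> identification (center_locus m S T) z e"
    by (intro exI conjI)
next
  fix T z and e :: "real ^ 'd \<Rightarrow> real ^ 'n"
  assume asm: "normalization S T \<and> identification (center_locus m S T) z e"
  have dim: "DIM(real ^ 'd) + m = DIM(real ^ 'n) + 2" using assms(2,3) by simp
  define R where "R = sqrt (2 * (real m - 1) / (real m - 2))"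
  have R: "0 < R" using assms(1) by (simp add: R_def)
  from asm have norm: "normalization S T" ..
  from asm obtain R' where e: "linear e" "\<And>v. norm (e v) = norm v" and R': "0 < R'"
    and L': "center_locus m S T = (\<lambda>u. z + R' *\<^sub>R e u) ` sphere 0 1"
    unfolding identification_def by blast
  \<comment> \<open>An arbitrary identification has an unspecified radius \<open>R'\<close>.
    Comparison with one of known radius \<open>R\<close> for the same sphere yields
    \<open>R' = R\<close>.\<close>
  obtain z0 and e0 :: "real ^ 'd \<Rightarrow> real ^ 'n" where e0: "linear e0" "\<And>v. norm (e0 v) = norm v"
    and L0: "center_locus m S T = (\<lambda>u. z0 + R *\<^sub>R e0 u) ` sphere 0 1"
    by (rule identification_exists[OF assms(5,1) norm dim, folded R_def]) (rule that)
  have "R' = R"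
    using isometric_sphere_radius_le[OF e e0(2) R, of z R' z0]
      isometric_sphere_radius_le[OF e0 e(2) R', of z0 R z] L' L0 by (intro antisym) auto
  then have L: "center_locus m S T = (\<lambda>u. z + R *\<^sub>R e u) ` sphere 0 1" using L' by simp
  obtain a b c where *: "norm a = 1" "T ` S 1 = ehyperplane a b" "T ` S 2 = ehyperplane a (b + 2)"
    "\<And>i. i \<in> {3..m} \<Longrightarrow> T ` S i = esphere (c i) 1"
    "\<And>i. i \<in> {3..m} \<Longrightarrow> a \<bullet> c i = b + 1"
    by (rule normalized_family[OF assms(5,1) norm]) (rule that)
  have "a \<noteq> 0" using *(1) by auto
  have locus: "center_locus m S T = {x. a \<bullet> x = b + 1} \<inter> (\<Inter>i\<in>{3..m}. sphere (c i) 2)"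
    using \<open>a \<noteq> 0\<close> *(2-4) by (rule center_locus_eq)
  obtain q k where k: "0 < k" and T: "T = map_option ((*\<^sub>R) k) \<circ> inversion q"
    using norm unfolding normalization_def by (elim conjE exE)
  have bij: "bij T" by (rule bij_scaled_inversion[OF k T])
  have inj: "inj T" using bij by (rule bij_is_inj)
  have X: "norm x = 1" if "x \<in> X" for x
    using assms(4) that by (auto simp: spherical_code_def)
  define p where "p = (\<lambda>x. z + R *\<^sub>R e x)"
  \<comment> \<open>The member of the arrangement belonging to \<open>x\<close>: a sphere or a
    hyperplane that \<open>T\<close> turns into the unit sphere about \<open>p x\<close>.\<close>
  define K where "K = (\<lambda>x. T -` esphere (p x) 1)"
  have TK: "T ` K x = esphere (p x) 1" for x
    unfolding K_def using bij by (simp add: bij_is_surj)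
  have pL: "p x \<in> center_locus m S T" if "x \<in> X" for x
    unfolding L p_def using X[OF that] by (intro image_eqI[OF refl]) simp
  have p: "a \<bullet> p x = b + 1" "\<And>i. i \<in> {3..m} \<Longrightarrow> dist (c i) (p x) = 2" if "x \<in> X" for x
  proof -
    note pL[OF that]
    then show "a \<bullet> p x = b + 1" "\<And>i. i \<in> {3..m} \<Longrightarrow> dist (c i) (p x) = 2"
      unfolding locus by auto
  qed
  have "gsphere (K x)" for x
    using gsphere_scaled_inversion_iff[OF k T, of "K x"] unfolding TK gsphere_def
    using zero_less_one by blast
  moreover have "tangent (K x) (S i)" if "x \<in> X" "i \<in> {1..m}" for x i
  proof -
    have sym: "tangent A B \<Longrightarrow> tangent B A" for A B :: "(real ^ 'n) option set"
      by (simp add: tangent_def Int_commute)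
    \<comment> \<open>The first two members become planes at distance 1 from \<open>p x\<close>, the
      others unit spheres with centres at distance 2 from it.\<close>
    have "i = 1 \<or> i = 2 \<or> i \<in> {3..m}" using that(2) by auto
    then have "tangent (T ` S i) (T ` K x)"
    proof (elim disjE)
      assume "i = 1"
      show ?thesis
        unfolding \<open>i = 1\<close> TK *(2) tangent_ehyperplane_esphere_iff[OF *(1) zero_less_one]
        using p(1)[OF that(1)] by simp
    next
      assume "i = 2"
      show ?thesis
        unfolding \<open>i = 2\<close> TK *(3) tangent_ehyperplane_esphere_iff[OF *(1) zero_less_one]
        using p(1)[OF that(1)] by simp
    next
      assume "i \<in> {3..m}"
      then show ?thesis
        using p(2)[OF that(1)] by (simp only: TK *(4) tangent_esphere_1_iff)
    qed
    then show ?thesis using sym by (simp add: tangent_image_iff[OF inj])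
  qed
  ultimately have all: "tangent_to_all (S ` {1..m}) (K ` X)"
    by (auto simp: tangent_to_all_def)
  \<comment> \<open>The case \<open>x = y\<close> is included, so no separate argument is needed
    when the second kissing condition is translated into angles.\<close>
  have tang: "tangent (K x) (K y) \<longleftrightarrow> angular_dist x y = arccos (1 / (real m - 1))"
    if "x \<in> X" "y \<in> X" for x y
  proof -
    have "tangent (K x) (K y) \<longleftrightarrow> dist (p x) (p y) = 2"
      using tangent_image_iff[OF inj, of "K x" "K y"] by (simp add: TK tangent_esphere_1_iff)
    then show ?thesis
      unfolding p_def using dist_kissing_sphere(2)[OF e X X assms(1) R_def] that by simp
  qed
  have "non_intersecting (K x) (K y)" if "x \<in> X" "y \<in> X" "x \<noteq> y" for x y
  proof -
    have "arccos (1 / (real m - 1)) \<le> angular_dist x y"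
      using assms(4) that by (auto simp: spherical_code_def pairwise_def)
    then have "2 \<le> dist (p x) (p y)"
      unfolding p_def using dist_kissing_sphere(1)[OF e X X assms(1) R_def] that by simp
    then have "non_intersecting (T ` K x) (T ` K y)"
      unfolding TK by (rule non_intersecting_esphere_1)
    then show ?thesis by (simp add: non_intersecting_image_iff[OF inj])
  qed
  then have ni: "pairwise non_intersecting (K ` X)" by (auto simp: pairwise_def)
  \<comment> \<open>The transformed arrangement consists of unit spheres about the points
    \<open>p x\<close>, and central projection takes \<open>p x\<close> back to
    \<open>x\<close>.\<close>
  have "(`) T ` K ` X = (\<lambda>c. esphere c 1) ` p ` X" by (simp add: image_image TK)
  then have "centers ((`) T ` K ` X) = p ` X" by (simp add: centers_unit_spheres)
  moreover have "p ` X \<subseteq> center_locus m S T" using pL by blast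
  moreover have "central_projection z e ` p ` X = X"
    using central_projection_eq[OF e R X] by (simp add: image_image p_def)
  ultimately have corr: "corresponds m S T z e (K ` X) X" by (simp add: corresponds_def)
  \<comment> \<open>Tangency to the family and non-intersection are already established, so only the
    demand for a touching partner remains; \<open>tang\<close> turns it into the angle
    condition.\<close>
  have "kissing_arrangement (S ` {1..m}) (K ` X) \<longleftrightarrow>
      (\<forall>x\<in>X. \<exists>y\<in>X. angular_dist x y = arccos (1 / (real m - 1)))"
    using all ni tang by (simp add: kissing_arrangement_def)
  then show "\<exists>P. tangent_to_all (S ` {1..m}) P \<and>
                 pairwise non_intersecting P \<and>
                 corresponds m S T z e P X \<and>
                 (kissing_arrangement (S ` {1..m}) P \<longleftrightarrow>
                    (\<forall>x\<in>X. \<exists>y\<in>X. angular_dist x y = arccos (1 / (real m - 1))))"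
    using all ni corr by blast
qed

end
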